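(* Let $n,S\geq 1$ be integers, let $\mathcal{K}\subseteq\mathbb{R}^n$ be a nonempty closed convex cone, and let $\mathbf{f}_i\in\mathbb{R}^n$, $d_i\in\mathbb{R}$ for $i\in\{0,1,\dots,S\}$ and $g_i\in\mathbb{R}$ for $i\in\{1,\dots,S\}$. Define $$\mathcal{F}_0=\{\mathbf{x}\in\mathcal{K}:\mathbf{f}_0^{\mathsf T}\mathbf{x}=d_0\},\qquad \mathcal{F}_i=\{[\mathbf{x}^{\mathsf T},y_i]^{\mathsf T}\in\mathcal{K}\times\mathbb{R}_+:\mathbf{f}_i^{\mathsf T}\mathbf{x}+g_iy_i=d_i\},\quad i=1,\dots,S,$$ and let $\mathcal{X}=\bigcap_{i=0}^S\mathcal{X}_i\subseteq\mathbb{R}^n\times\mathcal{S}^n$, where the sets $\mathcal{X}_i$ are defined from $\mathcal{F}_i$ as in the context. Assume that i'. $g_i>0$ for all $i\in\{1,\dots,S\}$; ii'. $\mathcal{X}$ is bounded; iii'. every extreme point of $\mathcal{X}$ is of the form $(\mathbf{x},\mathbf{x}\mathbf{x}^{\mathsf T})$. Let $\mathsf{M}_{G}\in\mathcal{PCP}_{G}(\mathbb{R}_+\times\mathcal{K}\times\mathbb{R}_+^S)$ with $G=G_{n+1,1}^S$ be a partial matrix whose (maximal) fully specified principal submatrices $\mathsf{M}_i\in\mathcal{S}^{n+2}$, $i=1,\dots,S$, satisfy $$\mathsf{M}_i=\begin{bmatrix}1&\mathbf{x}^{\mathsf T}&y_i\\ \mathbf{x}&\mathsf{X}&\mathbf{z}_i\\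 y_i&\mathbf{z}_i^{\mathsf T}&Y_i\end{bmatrix}\in\mathcal{CPP}(\mathbb{R}_+\times\mathcal{K}\times\mathbb{R}_+),\qquad \mathbf{f}_i^{\mathsf T}\mathbf{x}+g_iy_i=d_i,\qquad \mathbf{f}_i\mathbf{f}_i^{\mathsf T}\bullet\mathsf{X}+2g_i\mathbf{f}_i^{\mathsf T}\mathbf{z}_i+g_i^2Y_i=d_i^2$$ for all $i=1,\dots,S$ (with $\mathbf{x},\mathbf{z}_i\in\mathbb{R}^n$, $\mathsf{X}\in\mathcal{S}^n$, $y_i,Y_i\in\mathbb{R}$), together with $\mathbf{f}_0^{\mathsf T}\mathbf{x}=d_0$ and $\mathbf{f}_0\mathbf{f}_0^{\mathsf T}\bullet\mathsf{X}=d_0^2$. Then $\mathsf{M}_G$ can be completed to a matrix $\mathsf{M}\in\mathcal{CPP}(\mathbb{R}_+\times\mathcal{K}\times\mathbb{R}_+^S)$, i.e. the unspecified entries can be assigned real values so that the resulting full symmetric matrix lies in $\mathcal{CPP}(\mathbb{R}_+\times\mathcal{K}\times\mathbb{R}_+^S)$.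
   Context: $\mathcal{S}^k$ denotes the real symmetric $k\times k$ matrices, and $\mathsf{A}\bullet\mathsf{B}=\mathrm{trace}(\mathsf{A}^{\mathsf T}\mathsf{B})$. For a nonempty closed convex cone $\mathcal{C}\subseteq\mathbb{R}^k$, the set-completely positive matrix cone is $\mathcal{CPP}(\mathcal{C})=\mathrm{conv}\{\mathbf{x}\mathbf{x}^{\mathsf T}:\mathbf{x}\in\mathcal{C}\}\subseteq\mathcal{S}^k$. For $\mathcal{F}\subseteq\mathbb{R}^k$, $\mathcal{G}(\mathcal{F})=\mathrm{cl}\,\mathrm{conv}\left\{\begin{bmatrix}1\\ \mathbf{x}\end{bmatrix}\begin{bmatrix}1\\ \mathbf{x}\end{bmatrix}^{\mathsf T}:\mathbf{x}\in\mathcal{F}\right\}\subseteq\mathcal{S}^{k+1}$. The sets $\mathcal{X}_i$ are $$\mathcal{X}_0=\left\{(\mathbf{x},\mathsf{X})\in\mathbb{R}^n\times\mathcal{S}^n:\begin{bmatrix}1&\mathbf{x}^{\mathsf T}\\ \mathbf{x}&\mathsf{X}\end{bmatrix}\in\mathcal{G}(\mathcal{F}_0)\right\},$$ $$\mathcal{X}_i=\left\{(\mathbf{x},\mathsf{X})\in\mathbb{R}^n\times\mathcal{S}^n:\exists\,(y,Y,\mathbf{z})\in\mathbb{R}\times\mathbb{R}\times\mathbb{R}^n:\begin{bmatrix}1&\mathbf{x}^{\mathsf T}&y\\ \mathbf{x}&\mathsf{X}&\mathbf{z}\\ y&\mathbf{z}^{\mathsf T}&Y\end{bmatrix}\in\mathcal{G}(\mathcal{F}_i)\right\},\quad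 i=1,\dots,S.$$ Partial matrices: for an undirected graph $G=(\mathcal{V},\mathcal{E})$ on $\mathcal{V}=\{1,\dots,N\}$, a symmetric partial matrix with specification graph $G$ is a symmetric $N\times N$ array whose $(i,j)$ entry is specified (a real number) if and only if $\{i,j\}\in\mathcal{E}$ or $i=j$; the remaining entries are unspecified. $\mathcal{PCP}_G(\mathcal{C})$, for a closed convex cone $\mathcal{C}\subseteq\mathbb{R}^N$, is the set of symmetric partial matrices with specification graph $G$ such that every fully specified principal submatrix is equal to the principal submatrix, induced by the same rows and columns, of some matrix in $\mathcal{CPP}(\mathcal{C})$. $G_{n_1,n_2}^S$ is the arrowhead specification graph on $n_1+Sn_2$ vertices: the vertices are partitioned into consecutive groups, the first of size $n_1$ and the next $S$ of size $n_2$; each group is a clique, each vertex of the first group is adjacent to all other vertices, and there are no edges between different groups of size $n_2$. Hence for $G_{n+1,1}^S$ the partial matrix is of order $n+1+S$, its unspecified entries are exactly the off-diagonal entries of the lower-right $S\times S$ block, and $\mathsf{M}_i$ is the principal submatrix induced by the indices $1,\dots,n+1$ and $n+1+i$. *)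

theory Defs
  imports "HOL-Analysis.Analysis"
begin

text \<open>
  A disjoint sum of index types encodes a block structure: \<open>real ^ ('a + 'b)\<close> consists of the
  block vectors \<open>[x; y]\<close>.  The one-element index type \<open>1\<close> encodes a block of size one, with
  \<open>vec c\<close> and \<open>mat c\<close> the vector and the matrix having the single entry \<open>c\<close>.
\<close>

definition vapp :: "real ^ 'a \<Rightarrow> real ^ 'b \<Rightarrow> real ^ ('a + 'b)" where
  "vapp x y = (\<chi> i. case i of Inl a \<Rightarrow> x $ a | Inr b \<Rightarrow> y $ b)"

text \<open>The block matrix \<open>[A, B; transpose B, D]\<close>.\<close>

definition sym_block ::
  "real ^ 'a ^ 'a \<Rightarrow> real ^ 'b ^ 'a \<Rightarrow> real ^ 'b ^ 'b \<Rightarrow> real ^ ('a + 'b) ^ ('a + 'b)" where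
  "sym_block A B D = (\<chi> i j.
     (case (i, j) of
        (Inl a, Inl a') \<Rightarrow> A $ a $ a'
      | (Inl a, Inr b) \<Rightarrow> B $ a $ b
      | (Inr b, Inl a) \<Rightarrow> B $ a $ b
      | (Inr b, Inr b') \<Rightarrow> D $ b $ b'))"

text \<open>The matrix \<open>[1, transpose x; x, X]\<close>.\<close>

definition block2 :: "real ^ 'n \<Rightarrow> real ^ 'n ^ 'n \<Rightarrow> real ^ (1 + 'n) ^ (1 + 'n)" where
  "block2 x X = sym_block (mat 1) (rowvector x) X"

text \<open>The matrix \<open>[1, transpose x, y; x, X, z; y, transpose z, Y]\<close>.\<close>

definition block3 ::
  "real ^ 'n \<Rightarrow> real ^ 'n ^ 'n \<Rightarrow> real \<Rightarrow> real ^ 'n \<Rightarrow> real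
     \<Rightarrow> real ^ (1 + ('n + 1)) ^ (1 + ('n + 1))" where
  "block3 x X y z Y = block2 (vapp x (vec y)) (sym_block X (columnvector z) (mat Y))"

definition outer :: "real ^ 'k \<Rightarrow> real ^ 'k ^ 'k" where
  "outer x = (\<chi> i j. x $ i * x $ j)"

definition frob :: "real ^ 'k ^ 'k \<Rightarrow> real ^ 'k ^ 'k \<Rightarrow> real"  (infixl "\<bullet>\<^sub>F" 70) where
  "A \<bullet>\<^sub>F B = trace (transpose A ** B)"

definition nonneg_orthant :: "(real ^ 'k) set" where
  "nonneg_orthant = {x. \<forall>i. 0 \<le> x $ i}"

definition vprod :: "(real ^ 'a) set \<Rightarrow> (real ^ 'b) set \<Rightarrow> (real ^ ('a + 'b)) set"
    (infixr "\<times>\<^sub>v" 80) where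
  "A \<times>\<^sub>v B = {vapp a b | a b. a \<in> A \<and> b \<in> B}"

definition CPP :: "(real ^ 'k) set \<Rightarrow> (real ^ 'k ^ 'k) set" where
  "CPP C = convex hull {outer x | x. x \<in> C}"

definition lift_hull :: "(real ^ 'k) set \<Rightarrow> (real ^ (1 + 'k) ^ (1 + 'k)) set" where
  "lift_hull F = closure (convex hull {outer (vapp (vec 1) x) | x. x \<in> F})"

definition F_first :: "(real ^ 'n) set \<Rightarrow> real ^ 'n \<Rightarrow> real \<Rightarrow> (real ^ 'n) set" where
  "F_first K f0 d0 = {x \<in> K. f0 \<bullet> x = d0}"

definition F_second ::
  "(real ^ 'n) set \<Rightarrow> real ^ 'n \<Rightarrow> real \<Rightarrow> real \<Rightarrow> (real ^ ('n + 1)) set" where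
  "F_second K f g d = {vapp x (vec y) | x y. x \<in> K \<and> 0 \<le> y \<and> f \<bullet> x + g * y = d}"

definition X_first :: "(real ^ 'n) set \<Rightarrow> ((real ^ 'n) \<times> (real ^ 'n ^ 'n)) set" where
  "X_first F = {(x, X). transpose X = X \<and> block2 x X \<in> lift_hull F}"

definition X_second :: "(real ^ ('n + 1)) set \<Rightarrow> ((real ^ 'n) \<times> (real ^ 'n ^ 'n)) set" where
  "X_second F = {(x, X). transpose X = X \<and> (\<exists>y Y z. block3 x X y z Y \<in> lift_hull F)}"

definition X_all ::
  "(real ^ 'n) set \<Rightarrow> real ^ 'n \<Rightarrow> real \<Rightarrow> ('s \<Rightarrow> real ^ 'n) \<Rightarrow> ('s \<Rightarrow> real) \<Rightarrow> ('s \<Rightarrow> real)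
     \<Rightarrow> ((real ^ 'n) \<times> (real ^ 'n ^ 'n)) set" where
  "X_all K f0 d0 f g d =
     X_first (F_first K f0 d0) \<inter> (\<Inter>i. X_second (F_second K (f i) (g i) (d i)))"

text \<open>
  A graph is given by its set of edges \<open>{i, j}\<close>, and an unspecified entry of a partial matrix
  is \<open>None\<close>.
\<close>

type_synonym 'v partial_matrix = "'v \<Rightarrow> 'v \<Rightarrow> real option"

definition sym_partial_matrix :: "'v set set \<Rightarrow> 'v partial_matrix \<Rightarrow> bool" where
  "sym_partial_matrix E M \<longleftrightarrow>
     (\<forall>i j. M i j = M j i) \<and> (\<forall>i j. M i j \<noteq> None \<longleftrightarrow> {i, j} \<in> E \<or> i = j)"

definition PCP :: "'v set set \<Rightarrow> (real ^ 'v) set \<Rightarrow> ('v::finite) partial_matrix set" where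
  "PCP E C = {M. sym_partial_matrix E M \<and>
     (\<forall>\<alpha>. (\<forall>i\<in>\<alpha>. \<forall>j\<in>\<alpha>. M i j \<noteq> None) \<longrightarrow>
        (\<exists>N\<in>CPP C. \<forall>i\<in>\<alpha>. \<forall>j\<in>\<alpha>. M i j = Some (N $ i $ j)))}"

definition completes :: "real ^ 'v ^ 'v \<Rightarrow> 'v partial_matrix \<Rightarrow> bool" where
  "completes N M \<longleftrightarrow> (\<forall>i j. M i j \<noteq> None \<longrightarrow> M i j = Some (N $ i $ j))"

text \<open>
  The arrowhead graph: the first group of vertices is \<open>'a\<close>, and the remaining groups are the
  copies \<open>{s} \<times> 'b\<close> of \<open>'b\<close>, one for each \<open>s\<close>.
\<close>

definition arrowhead :: "('a + 's \<times> 'b) set set" where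
  "arrowhead = {{u, v} | u v. u \<noteq> v \<and>
     (u \<in> range Inl \<or> v \<in> range Inl \<or> (\<exists>s b b'. u = Inr (s, b) \<and> v = Inr (s, b')))}"

text \<open>
  The inclusion of the index set of \<open>block3\<close> as the first group together with the vertex of
  group \<open>s\<close>.
\<close>

definition arrow_emb :: "'s \<Rightarrow> 1 + ('n + 1) \<Rightarrow> (1 + 'n) + 's \<times> 1" where
  "arrow_emb s p = (case p of
      Inl u \<Rightarrow> Inl (Inl u)
    | Inr (Inl j) \<Rightarrow> Inl (Inr j)
    | Inr (Inr u) \<Rightarrow> Inr (s, u))"

definition principal_submatrix ::
  "'v partial_matrix \<Rightarrow> ('w \<Rightarrow> 'v) \<Rightarrow> real ^ 'w ^ 'w \<Rightarrow> bool" where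
  "principal_submatrix M e A \<longleftrightarrow> (\<forall>p q. M (e p) (e q) = Some (A $ p $ q))"

end

theory Submission
  imports Defs
begin

text \<open>
  Since \<open>g i > 0\<close>, the linear constraint makes the slack coordinate of a point of \<open>F i\<close> a function
  of \<open>x\<close>.  At the level of matrices, put \<open>w = (- d, f, g)\<close>: every point \<open>u\<close> of \<open>F i\<close> satisfies
  \<open>w \<bullet> (1, u) = 0\<close>, so every matrix of \<open>lift_hull (F i)\<close> has \<open>w\<close> in its kernel
  (\<open>lift_hull_mult_eq_0\<close>), and this determines \<open>y\<close>, \<open>z\<close> and \<open>Y\<close> as affine functions of \<open>(x, X)\<close>
  (\<open>block3_eq_slack_lift\<close>).  The set \<open>X_all\<close> is therefore an intersection of preimages of closed
  convex sets under continuous affine maps.  Being bounded as well, it is the convex hull of its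
  extreme points by the Krein--Milman--Minkowski theorem.

  The given \<open>(x, X)\<close> lies in \<open>X_all\<close>.  Indeed, the two constraints on a submatrix \<open>M\<close>
  (on \<open>block2 x X\<close>, with \<open>w = (- d0, f0)\<close>, for the first set) say that the quadratic form of \<open>M\<close> vanishes at \<open>w\<close>.  As \<open>M\<close> is a nonnegative combination of
  matrices \<open>outer v\<close>, every vector \<open>v\<close> of positive weight in it is orthogonal to \<open>w\<close>.  Those with a positive
  leading entry are scaled to points of the slice \<open>F i\<close>, and those with a zero leading entry are
  recession directions of that slice, which the closure in \<open>lift_hull\<close> absorbs (\<open>CPP_slice\<close>).

  It remains to complete the matrix for an extreme point \<open>(v, outer v)\<close> of \<open>X_all\<close>, because the set of
  those \<open>(x, X)\<close> whose prescribed submatrices, which depend affinely on \<open>(x, X)\<close>, have a common completion is convex.  There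
  \<open>v \<in> K\<close> and the slacks \<open>t i = (d i - f i \<bullet> v) / g i\<close> are nonnegative, since first rows of
  \<open>lift_hull F\<close> stay in the closed convex set \<open>F\<close> (\<open>X_all_rank_one\<close>); the completion is
  \<open>outer (1, v, t)\<close>, whose submatrices are the prescribed ones because they have \<open>w\<close> in the kernel
  (\<open>slack_lift_outer\<close>).
\<close>

section \<open>Block vectors and block matrices\<close>

lemma vapp_nth [simp]: "vapp x y $ Inl a = x $ a" "vapp x y $ Inr b = y $ b"
  by (simp_all add: vapp_def)

lemma vapp_eq_iff [simp]: "vapp x y = vapp x' y' \<longleftrightarrow> x = x' \<and> y = y'"
  by (metis vapp_nth vec_eq_iff)

lemma vapp_arith:
  "vapp x y + vapp x' y' = vapp (x + x') (y + y')" "c *\<^sub>R vapp x y = vapp (c *\<^sub>R x) (c *\<^sub>R y)"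
  "vapp 0 0 = 0"
  by (simp_all add: vec_eq_iff vapp_def split: sum.split)

lemma vapp_exhaust: obtains x y where "v = vapp x y"
proof
  show "v = vapp (\<chi> i. v $ Inl i) (\<chi> i. v $ Inr i)"
    by (simp add: vec_eq_iff vapp_def split: sum.split)
qed

lemma sum_UNIV_Plus:
  "(\<Sum>i\<in>(UNIV :: ('a::finite + 'b::finite) set). h i) = (\<Sum>a\<in>UNIV. h (Inl a)) + (\<Sum>b\<in>UNIV. h (Inr b))"
  by (simp add: UNIV_Plus_UNIV[symmetric] sum.Plus del: UNIV_Plus_UNIV)

lemma inner_vapp: "vapp a b \<bullet> vapp a' b' = a \<bullet> a' + b \<bullet> b'"
  by (simp add: inner_vec_def sum_UNIV_Plus)

lemma vec1_eq: "(v :: real ^ 1) = vec (v $ 1)"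
  by (simp add: vec_eq_iff)

lemma vec1_inj: "vec a = (vec b :: real ^ 1) \<longleftrightarrow> a = b"
  by (simp add: vec_eq_iff)

lemma inner_vec1: "vec a \<bullet> (vec b :: real ^ 1) = a * b" "1 \<bullet> (vec b :: real ^ 1) = b"
  by (simp_all add: inner_vec_def)

lemma vec_arith: "c *\<^sub>R (vec a :: real ^ 'k) = vec (c * a)" "(vec 0 :: real ^ 'k) = 0"
   "vec a + vec b = (vec (a + b) :: real ^ 'k)"
  by (simp_all add: vec_eq_iff)

lemma sym_block_mult_vapp:
  "sym_block A B D *v vapp a b = vapp (A *v a + B *v b) (transpose B *v a + D *v b)"
  unfolding vec_eq_iff matrix_vector_mult_def
  by (auto simp: sym_block_def vapp_def transpose_def sum_UNIV_Plus split: sum.split)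

lemma block2_mult:
  "block2 x X *v vapp (vec t) u = vapp (vec (t + x \<bullet> u)) (t *\<^sub>R x + X *v u)"
  unfolding block2_def sym_block_mult_vapp vapp_eq_iff
  by (simp add: vec_eq_iff matrix_vector_mult_def rowvector_def transpose_def mat_def inner_vec_def
       mult.commute)

lemma block3_mult:
  "block3 x X y z Y *v vapp (vec t) (vapp a (vec b)) =
     vapp (vec (t + x \<bullet> a + y * b)) (vapp (t *\<^sub>R x + X *v a + b *\<^sub>R z) (vec (t * y + z \<bullet> a + Y * b)))"
  unfolding block3_def block2_mult sym_block_mult_vapp vapp_arith inner_vapp inner_vec1 vapp_eq_iff
  by (simp add: vec_eq_iff matrix_vector_mult_def columnvector_def transpose_def mat_def inner_vec_def
       mult.commute algebra_simps)

lemma outer_mult: "outer v *v w = (v \<bullet> w) *\<^sub>R v"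
  by (simp add: vec_eq_iff matrix_vector_mult_def outer_def inner_vec_def sum_distrib_left
        sum_distrib_right mult_ac)

lemma outer_scaleR: "outer (c *\<^sub>R v) = c\<^sup>2 *\<^sub>R outer v"
  by (simp add: vec_eq_iff outer_def power2_eq_square mult_ac)

lemma frob_outer: "outer a \<bullet>\<^sub>F X = a \<bullet> (X *v a)"
  unfolding frob_def trace_def transpose_def matrix_matrix_mult_def outer_def inner_vec_def matrix_vector_mult_def
  by (simp, subst sum.swap, simp add: sum_distrib_left mult_ac)

lemma mult_sum_scaleR:
  "(\<Sum>v\<in>T. c v *\<^sub>R (A v :: real ^ 'k ^ 'm)) *v w = (\<Sum>v\<in>T. c v *\<^sub>R (A v *v w))"
  by (induction T rule: infinite_finite_induct)
     (simp_all add: matrix_vector_mult_add_rdistrib scaleR_matrix_vector_assoc)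

lemma closed_mult_eq_0: "closed {M :: real ^ 'k ^ 'm. M *v w = 0}"
proof -
  have "linear (\<lambda>M :: real ^ 'k ^ 'm. M *v w)"
    by (rule linearI) (simp_all add: matrix_vector_mult_add_rdistrib scaleR_matrix_vector_assoc)
  then show ?thesis
    by (intro closed_Collect_eq) (auto intro: linear_continuous_on linear_conv_bounded_linear[THEN iffD1])
qed

section \<open>Lifted convex hulls\<close>

lemma lift_hull_induct: 
  assumes "M \<in> lift_hull F" "closed {M. P M}" "convex {M. P M}" "\<And>u. u \<in> F \<Longrightarrow> P (outer (vapp (vec 1) u))"
  shows "P M"
proof -
  have "lift_hull F \<subseteq> {M. P M}"
    unfolding lift_hull_def using assms by (intro closure_minimal hull_minimal) auto
  then show ?thesis using assms(1) by auto
qed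

lemma lift_hull_mult_eq_0:
  assumes "M \<in> lift_hull F" "\<And>u. u \<in> F \<Longrightarrow> a \<bullet> u = d"
  shows "M *v vapp (vec (- d)) a = 0"
  using assms(1)
proof (rule lift_hull_induct)
  show "convex {M. M *v vapp (vec (- d)) a = 0}"
    by (rule convexI) (simp add: matrix_vector_mult_add_rdistrib scaleR_matrix_vector_assoc[symmetric])
  fix u assume "u \<in> F"
  then have "u \<bullet> a = d" using assms(2)[of u] by (simp add: inner_commute)
  then show "outer (vapp (vec 1 :: real ^ 1) u) *v vapp (vec (- d)) a = 0"
    by (simp add: outer_mult inner_vapp inner_vec1)
qed (rule closed_mult_eq_0)

lemma closed_convex_lift_hull: "closed (lift_hull F)" "convex (lift_hull F)"
  by (simp_all add: lift_hull_def convex_closure)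

lemma outer_in_lift_hull: "u \<in> F \<Longrightarrow> outer (vapp (vec 1) u) \<in> lift_hull F"
  unfolding lift_hull_def by (auto intro!: subsetD[OF closure_subset] hull_inc)

text \<open>
  For closed convex \<open>F\<close> the map taking a matrix to its first row, without the corner entry, sends
  \<open>lift_hull F\<close> into \<open>F\<close>.
\<close>

lemma lift_hull_first_row:
  assumes "block2 u U \<in> lift_hull F" "closed F" "convex F"
  shows "u \<in> F"
proof -
  define L :: "real ^ (1 + 'a) ^ (1 + 'a) \<Rightarrow> real ^ 'a" where "L = (\<lambda>M. \<chi> j. M $ Inl 1 $ Inr j)"
  have L: "linear L"
    by (rule linearI) (simp_all add: L_def vec_eq_iff)
  have "L (block2 u U) \<in> F"
    using assms(1)
  proof (rule lift_hull_induct)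
    have "{M. L M \<in> F} = L -` F" by auto
    with L assms show "closed {M. L M \<in> F}" "convex {M. L M \<in> F}"
      by (auto intro!: convex_linear_vimage continuous_closed_vimage linear_continuous_at
          simp: linear_conv_bounded_linear)
    fix v assume "v \<in> F"
    moreover have "L (outer (vapp (vec 1) v)) = v"
      by (simp add: L_def outer_def vec_eq_iff)
    ultimately show "L (outer (vapp (vec 1) v)) \<in> F" by simp
  qed
  moreover have "L (block2 u U) = u"
    by (simp add: L_def block2_def sym_block_def rowvector_def vec_eq_iff)
  ultimately show ?thesis by simp
qed

text \<open>
  Here \<open>r\<close> is a recession direction of the slice, so \<open>(1, p + r / e)\<close> is a lifted point of the slice for
  every \<open>e > 0\<close>.  Giving it the weight \<open>e\<^sup>2\<close> and \<open>A\<close> the weight \<open>1 - e\<^sup>2\<close>, the combination tends to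
  \<open>A + outer (0, r)\<close> as \<open>e\<close> tends to \<open>0\<close>.
\<close>

lemma lift_hull_add_recession:
  assumes "cone C" "convex C" "A \<in> lift_hull {u\<in>C. a \<bullet> u = d}" "p \<in> C" "a \<bullet> p = d" "r \<in> C" "a \<bullet> r = 0"
  shows "A + outer (vapp (vec 0) r) \<in> lift_hull {u\<in>C. a \<bullet> u = d}"
proof -
  define F where "F = {u\<in>C. a \<bullet> u = d}"
  define e where "e n = inverse (real (Suc n))" for n
  have e: "0 < e n" "e n \<le> 1" for n by (simp_all add: e_def field_simps)
  have e0: "e \<longlonglongrightarrow> 0"
    using LIMSEQ_inverse_real_of_nat by (simp add: e_def[abs_def])
  define B where "B n = (1 - (e n)\<^sup>2) *\<^sub>R A + (e n)\<^sup>2 *\<^sub>R outer (vapp (vec 1) (p + inverse (e n) *\<^sub>R r))" for n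
  have "B n \<in> lift_hull F" for n
    unfolding B_def
  proof (rule convexD[OF closed_convex_lift_hull(2)])
    have "inverse (e n) *\<^sub>R r \<in> C" using assms e[of n] by (simp add: cone_def)
    then have "p + inverse (e n) *\<^sub>R r \<in> C"
      using assms convex_cone[of C] by blast
    then show "outer (vapp (vec 1) (p + inverse (e n) *\<^sub>R r)) \<in> lift_hull F"
      using assms by (intro outer_in_lift_hull) (simp add: F_def inner_add_right)
    show "0 \<le> 1 - (e n)\<^sup>2" using e[of n] by (simp add: power_le_one)
  qed (use assms F_def in auto)
  moreover have "B \<longlonglongrightarrow> A + outer (vapp (vec 0) r)"
  proof -
    have "e n \<noteq> 0" for n using e(1)[of n] by simp
    then have eq: "B = (\<lambda>n. (1 - (e n)\<^sup>2) *\<^sub>R A + outer (vapp (vec (e n)) (e n *\<^sub>R p + r)))"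
      unfolding B_def outer_scaleR[symmetric] vapp_arith vec_arith by (simp add: scaleR_add_right)
    have "(\<lambda>n. B n $ i $ j) \<longlonglongrightarrow> (A + outer (vapp (vec 0) r)) $ i $ j" for i j
      unfolding eq by (cases i; cases j) (auto intro!: tendsto_eq_intros e0 simp: outer_def)
    then show ?thesis by (intro vec_tendstoI)
  qed
  ultimately show ?thesis
    unfolding F_def[symmetric] using closed_convex_lift_hull(1) closed_sequentially by blast
qed

lemma lift_hull_add_cone:
  assumes "cone C" "convex C" "A \<in> lift_hull {u\<in>C. a \<bullet> u = d}" "p \<in> C" "a \<bullet> p = d"
    and "finite T" "\<And>i. i \<in> T \<Longrightarrow> 0 \<le> c i \<and> r i \<in> C \<and> a \<bullet> r i = 0"
  shows "A + (\<Sum>i\<in>T. c i *\<^sub>R outer (vapp (vec 0) (r i))) \<in> lift_hull {u\<in>C. a \<bullet> u = d}"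
  using assms(6,7)
proof (induction T rule: finite_induct)
  case (insert i T)
  then have i: "0 \<le> c i" "r i \<in> C" "a \<bullet> r i = 0" by auto
  have "sqrt (c i) *\<^sub>R r i \<in> C" using i assms(1) by (simp add: cone_def)
  moreover have "c i *\<^sub>R outer (vapp (vec 0 :: real ^ 1) (r i)) = outer (vapp (vec 0) (sqrt (c i) *\<^sub>R r i))"
    using outer_scaleR[of "sqrt (c i)" "vapp (vec 0) (r i) :: real ^ (1 + _)", symmetric] i(1)
    by (simp add: vapp_arith vec_arith)
  moreover have "A + (\<Sum>i\<in>T. c i *\<^sub>R outer (vapp (vec 0) (r i))) + 
      outer (vapp (vec 0) (sqrt (c i) *\<^sub>R r i)) \<in> lift_hull {u\<in>C. a \<bullet> u = d}"
    using insert i calculation by (intro lift_hull_add_recession[OF assms(1,2) _ assms(4,5)]) auto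
  ultimately show ?case
    using insert.hyps by (simp add: algebra_simps)
qed (use assms in auto)

text \<open>
  A completely positive matrix with corner entry \<open>1\<close> whose quadratic form vanishes at \<open>(- d, a)\<close>
  has that vector in its kernel and belongs to the lifted hull of the slice of the cone by the hyperplane \<open>a \<bullet> u = d\<close>.
\<close>

lemma CPP_slice:
  assumes C: "cone C" "convex C" and M: "M \<in> CPP (nonneg_orthant \<times>\<^sub>v C)" "M $ Inl 1 $ Inl 1 = 1"
    and w: "w = vapp (vec (- d)) a" "w \<bullet> (M *v w) = 0"
  shows "M *v w = 0" "M \<in> lift_hull {u\<in>C. a \<bullet> u = d}"
proof -
  from M(1) obtain S c where S: "finite S" "S \<subseteq> {outer x | x. x \<in> nonneg_orthant \<times>\<^sub>v C}"
      "\<And>A. A \<in> S \<Longrightarrow> 0 \<le> c A" and Msum: "M = (\<Sum>A\<in>S. c A *\<^sub>R A)"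
    unfolding CPP_def convex_hull_explicit by blast
  have "\<exists>t r. A = outer (vapp (vec t) r) \<and> 0 \<le> t \<and> r \<in> C" if "A \<in> S" for A
  proof -
    from that S(2) obtain b r where "A = outer (vapp b r)" "b \<in> nonneg_orthant" "r \<in> C"
      by (auto simp: vprod_def)
    then have "A = outer (vapp (vec (b $ 1)) r)" "0 \<le> b $ 1" "r \<in> C"
      using vec1_eq[of b] by (auto simp: nonneg_orthant_def)
    then show ?thesis by blast
  qed
  then obtain t r where tr: "\<And>A. A \<in> S \<Longrightarrow> A = outer (vapp (vec (t A)) (r A))"
      "\<And>A. A \<in> S \<Longrightarrow> 0 \<le> t A" "\<And>A. A \<in> S \<Longrightarrow> r A \<in> C"
    by metis
  define v where "v A = vapp (vec (t A) :: real ^ 1) (r A)" for A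
  have Msum: "M = (\<Sum>A\<in>S. c A *\<^sub>R outer (v A))"
    unfolding Msum v_def by (intro sum.cong) (simp_all add: tr(1)[symmetric])
  have vw: "v A \<bullet> w = a \<bullet> r A - d * t A" for A
    by (simp add: v_def w(1) inner_vapp inner_vec1 inner_commute)
  have "(\<Sum>A\<in>S. c A * (v A \<bullet> w)\<^sup>2) = 0"
    using w(2) unfolding Msum mult_sum_scaleR outer_mult 
    by (simp add: inner_sum_right power2_eq_square inner_commute mult_ac)
  \<comment> \<open>A vanishing sum of nonnegative terms: every matrix of positive weight comes from a vector orthogonal to \<open>w\<close>.\<close>
  then have c0: "c A = 0 \<or> v A \<bullet> w = 0" if "A \<in> S" for A
    using that S by (subst (asm) sum_nonneg_eq_0_iff) auto
  show "M *v w = 0"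
    unfolding Msum mult_sum_scaleR outer_mult using c0 by (intro sum.neutral) auto
  \<comment> \<open>\<open>T\<close> collects the points of the slice, up to scaling, and \<open>T0\<close> its recession directions.\<close>
  define T where "T = {A\<in>S. c A \<noteq> 0 \<and> t A \<noteq> 0}"
  define T0 where "T0 = {A\<in>S. c A \<noteq> 0 \<and> t A = 0}"
  have fin: "finite T" "finite T0" "T \<inter> T0 = {}" using S by (auto simp: T_def T0_def)
  have "M = (\<Sum>A\<in>T \<union> T0. c A *\<^sub>R outer (v A))"
    unfolding Msum using S(1) by (intro sum.mono_neutral_right) (auto simp: T_def T0_def)
  also have "\<dots> = (\<Sum>A\<in>T. c A *\<^sub>R outer (v A)) + (\<Sum>A\<in>T0. c A *\<^sub>R outer (v A))"
    using fin by (simp add: sum.union_disjoint)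
  also have "(\<Sum>A\<in>T0. c A *\<^sub>R outer (v A)) = (\<Sum>A\<in>T0. c A *\<^sub>R outer (vapp (vec 0) (r A)))"
    by (intro sum.cong) (auto simp: T0_def v_def)
  also have "(\<Sum>A\<in>T. c A *\<^sub>R outer (v A)) 
      = (\<Sum>A\<in>T. (c A * (t A)\<^sup>2) *\<^sub>R outer (vapp (vec 1) (inverse (t A) *\<^sub>R r A)))"
  proof (intro sum.cong refl)
    fix A assume "A \<in> T"
    then have "v A = t A *\<^sub>R vapp (vec 1) (inverse (t A) *\<^sub>R r A)"
      by (simp add: T_def v_def vapp_arith vec_arith del: vec_1)
    then show "c A *\<^sub>R outer (v A) = (c A * (t A)\<^sup>2) *\<^sub>R outer (vapp (vec 1) (inverse (t A) *\<^sub>R r A))"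
      by (simp add: outer_scaleR)
  qed
  finally have MT: "M = (\<Sum>A\<in>T. (c A * (t A)\<^sup>2) *\<^sub>R outer (vapp (vec 1) (inverse (t A) *\<^sub>R r A)))
      + (\<Sum>A\<in>T0. c A *\<^sub>R outer (vapp (vec 0) (r A)))" .
  have sum1: "(\<Sum>A\<in>T. c A * (t A)\<^sup>2) = 1"
    using M(2) unfolding MT by (simp add: outer_def)
  \<comment> \<open>The corner entry forces \<open>T\<close> to be nonempty, which supplies a base point of the slice.\<close>
  then obtain A0 where "A0 \<in> T" by force
  have inF: "inverse (t A) *\<^sub>R r A \<in> C" "a \<bullet> (inverse (t A) *\<^sub>R r A) = d" if "A \<in> T" for A
    using that c0[of A] tr(2,3)[of A] C(1) by (auto simp: T_def vw cone_def field_simps)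
  show "M \<in> lift_hull {u\<in>C. a \<bullet> u = d}"
    unfolding MT
  proof (rule lift_hull_add_cone[OF C _ inF])
    show "(\<Sum>A\<in>T. (c A * (t A)\<^sup>2) *\<^sub>R outer (vapp (vec 1) (inverse (t A) *\<^sub>R r A)))
        \<in> lift_hull {u\<in>C. a \<bullet> u = d}"
      using sum1 inF S(3)
      by (intro convex_sum fin closed_convex_lift_hull outer_in_lift_hull) (auto simp: T_def)
  next
    fix A assume "A \<in> T0"
    then show "0 \<le> c A \<and> r A \<in> C \<and> a \<bullet> r A = 0"
      using c0[of A] tr(3)[of A] S(3)[of A] by (auto simp: T0_def vw)
  qed (use fin \<open>A0 \<in> T\<close> in auto)
qed

section \<open>Submatrices and product cones\<close>

text \<open>
  The matrix with entries read off from \<open>M\<close> along the index map \<open>e\<close>; it is a principal submatrix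
  when \<open>e\<close> is injective, which is not required.
\<close>
definition submatrix :: "('w \<Rightarrow> 'v) \<Rightarrow> real ^ 'v ^ 'v \<Rightarrow> real ^ 'w ^ 'w" where
  "submatrix e M = (\<chi> p q. M $ e p $ e q)"

lemma linear_submatrix: "linear (submatrix e)"
  by (rule linearI) (simp_all add: submatrix_def vec_eq_iff)

lemma submatrix_outer: "submatrix e (outer v) = outer (\<chi> p. v $ e p)"
  by (simp add: submatrix_def outer_def)

lemma submatrix_CPP:
  assumes "M \<in> CPP C" "\<And>v. v \<in> C \<Longrightarrow> (\<chi> p. v $ e p) \<in> D"
  shows "submatrix e M \<in> CPP D"
proof -
  have "CPP C \<subseteq> submatrix e -` CPP D"
    unfolding CPP_def
    by (intro hull_minimal convex_linear_vimage linear_submatrix convex_convex_hull)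
       (auto simp: submatrix_outer intro!: hull_inc assms(2))
  then show ?thesis using assms(1) by auto
qed

lemma vapp_in_vprod [simp]: "vapp a b \<in> A \<times>\<^sub>v B \<longleftrightarrow> a \<in> A \<and> b \<in> B"
  by (auto simp: vprod_def)

lemma cone_vprod: "cone A \<Longrightarrow> cone B \<Longrightarrow> cone (A \<times>\<^sub>v B)"
  unfolding cone_def vprod_def by (fastforce simp: vapp_arith)

lemma convex_vprod: 
  assumes "convex A" "convex B" shows "convex (A \<times>\<^sub>v B)"
proof (rule convexI)
  fix p q u v assume "p \<in> A \<times>\<^sub>v B" "q \<in> A \<times>\<^sub>v B" and uv: "0 \<le> u" "0 \<le> v" "u + v = (1::real)"
  then obtain a b a' b' where "p = vapp a b" "q = vapp a' b'" "a \<in> A" "b \<in> B" "a' \<in> A" "b' \<in> B"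
    unfolding vprod_def by blast
  then show "u *\<^sub>R p + v *\<^sub>R q \<in> A \<times>\<^sub>v B"
    using assms uv unfolding vprod_def 
    by (auto simp: vapp_arith intro!: exI convexD[of A] convexD[of B])
qed

lemma closed_vprod: 
  fixes A :: "(real ^ 'a) set" and B :: "(real ^ 'b) set"
  assumes "closed A" "closed B" shows "closed (A \<times>\<^sub>v B)"
proof -
  have "A \<times>\<^sub>v B = (\<lambda>v. \<chi> i. v $ Inl i) -` A \<inter> (\<lambda>v. \<chi> i. v $ Inr i) -` B"
  proof (intro set_eqI)
    fix v :: "real ^ ('a + 'b)"
    obtain a b where "v = vapp a b" by (rule vapp_exhaust)
    then show "v \<in> A \<times>\<^sub>v B \<longleftrightarrow> v \<in> (\<lambda>v. \<chi> i. v $ Inl i) -` A \<inter> (\<lambda>v. \<chi> i. v $ Inr i) -` B"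
      by (auto simp: vprod_def)
  qed
  also have "closed \<dots>"
    using assms
    by (intro closed_Int closed_vimage continuous_on_vec_lambda) (auto intro!: continuous_intros)
  finally show ?thesis .
qed

lemma nonneg_orthant:
  "cone (nonneg_orthant :: (real ^ 'k) set)" "convex (nonneg_orthant :: (real ^ 'k) set)"
  "closed (nonneg_orthant :: (real ^ 'k) set)"
proof -
  show "cone (nonneg_orthant :: (real ^ 'k) set)" by (auto simp: cone_def nonneg_orthant_def)
  show "convex (nonneg_orthant :: (real ^ 'k) set)" by (auto simp: convex_def nonneg_orthant_def)
  show "closed (nonneg_orthant :: (real ^ 'k) set)"
    unfolding nonneg_orthant_def by (intro closed_Collect_all closed_Collect_le continuous_intros)
qed

lemma F_second_eq:
  fixes K :: "(real ^ 'n::finite) set"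
  shows "F_second K f g d = {u \<in> K \<times>\<^sub>v nonneg_orthant. vapp f (vec g) \<bullet> u = d}"
proof (intro set_eqI)
  fix u :: "real ^ ('n + 1)"
  obtain a b where u: "u = vapp a b" by (rule vapp_exhaust)
  have "u = vapp a (vec (b $ 1))" using u vec1_eq[of b] by simp
  then obtain b' where u: "u = vapp a (vec b')" by blast
  show "u \<in> F_second K f g d \<longleftrightarrow> u \<in> {u \<in> K \<times>\<^sub>v nonneg_orthant. vapp f (vec g) \<bullet> u = d}"
    unfolding u using vec1_inj
    by (auto simp: F_second_def nonneg_orthant_def inner_vapp inner_vec1)
qed

lemma closed_convex_slice:
  assumes "closed C" "convex C" shows "closed {u\<in>C. a \<bullet> u = d}" "convex {u\<in>C. a \<bullet> u = d}"
proof -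
  have "{u\<in>C. a \<bullet> u = d} = C \<inter> {u. a \<bullet> u = d}" by auto
  then show "closed {u\<in>C. a \<bullet> u = d}" "convex {u\<in>C. a \<bullet> u = d}"
    using assms by (auto intro: closed_Int convex_Int closed_hyperplane convex_hyperplane)
qed

section \<open>The slack part as an affine function of the first block\<close>

text \<open>
  The block matrix whose first block is \<open>p = (x, X)\<close> and whose remaining entries \<open>y\<close>, \<open>z\<close>, \<open>Y\<close> are
  the solution of \<open>block3 x X y z Y *v (- d, f, g) = 0\<close>, read row by row, for \<open>g \<noteq> 0\<close>.
\<close>
definition slack_lift ::
  "real ^ 'n \<Rightarrow> real \<Rightarrow> real \<Rightarrow> (real ^ 'n) \<times> (real ^ 'n ^ 'n) \<Rightarrow> real ^ (1 + ('n + 1)) ^ (1 + ('n + 1))"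
  where "slack_lift f g d p =
    (let x = fst p; X = snd p;
         y = (d - f \<bullet> x) / g; z = (1 / g) *\<^sub>R (d *\<^sub>R x - X *v f); Y = (d * y - f \<bullet> z) / g
     in block3 x X y z Y)"

lemma block3_eq_slack_lift:
  assumes "block3 x X y z Y *v vapp (vec (- d)) (vapp f (vec g)) = 0" "g \<noteq> 0"
  shows "block3 x X y z Y = slack_lift f g d (x, X)"
proof -
  have *: "- d + x \<bullet> f + y * g = 0" "- d *\<^sub>R x + X *v f + g *\<^sub>R z = 0" "- d * y + z \<bullet> f + Y * g = 0"
    using assms(1)[unfolded block3_mult vapp_arith(3)[symmetric] vapp_eq_iff vec_arith(2)[symmetric]]
    by (simp_all add: vec_eq_iff)
  have "g *\<^sub>R z = d *\<^sub>R x - X *v f" using *(2) by (simp add: algebra_simps eq_neg_iff_add_eq_0)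
  then have z: "z = (1 / g) *\<^sub>R (d *\<^sub>R x - X *v f)" using assms(2) by (metis divideR_right inverse_eq_divide)
  have y: "y = (d - f \<bullet> x) / g" "Y = (d * y - f \<bullet> z) / g" using * assms(2) 
    by (simp_all add: field_simps inner_commute)
  show ?thesis
    unfolding slack_lift_def Let_def fst_conv snd_conv z[symmetric] y(1)[symmetric] y(2)[symmetric] ..
qed

lemma block3_combination:
  assumes "u + v = 1"
  shows "block3 (u *\<^sub>R x + v *\<^sub>R x') (u *\<^sub>R X + v *\<^sub>R X') (u * y + v * y') (u *\<^sub>R z + v *\<^sub>R z') (u * Y + v * Y')
    = u *\<^sub>R block3 x X y z Y + v *\<^sub>R block3 x' X' y' z' Y'"
  using assms
  by (auto simp: block3_def block2_def sym_block_def vec_eq_iff vapp_def mat_def rowvector_def columnvector_def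
      split: sum.split)

lemma slack_lift_affine:
  assumes "u + v = 1"
  shows "slack_lift f g d (u *\<^sub>R p + v *\<^sub>R q) = u *\<^sub>R slack_lift f g d p + v *\<^sub>R slack_lift f g d q"
proof -
  have u: "u = 1 - v" using assms by simp
  obtain x X where p: "p = (x, X)" by (cases p)
  obtain x' X' where q: "q = (x', X')" by (cases q)
  define y where "y x = (d - f \<bullet> x) / g" for x
  define z where "z x X = (1 / g) *\<^sub>R (d *\<^sub>R x - X *v f)" for x and X :: "real ^ 'a ^ 'a"
  define Y where "Y x X = (d * y x - f \<bullet> z x X) / g" for x X
  have y: "y (u *\<^sub>R x + v *\<^sub>R x') = u * y x + v * y x'"
    by (simp add: y_def u inner_simps diff_divide_distrib add_divide_distrib algebra_simps)
  have z: "z (u *\<^sub>R x + v *\<^sub>R x') (u *\<^sub>R X + v *\<^sub>R X') = u *\<^sub>R z x X + v *\<^sub>R z x' X'"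
    by (simp add: z_def matrix_vector_mult_add_rdistrib scaleR_matrix_vector_assoc[symmetric] algebra_simps)
  have Y: "Y (u *\<^sub>R x + v *\<^sub>R x') (u *\<^sub>R X + v *\<^sub>R X') = u * Y x X + v * Y x' X'"
    unfolding Y_def y z by (simp add: inner_simps diff_divide_distrib add_divide_distrib algebra_simps)
  have s: "slack_lift f g d (x, X) = block3 x X (y x) (z x X) (Y x X)" for x X
    by (simp add: slack_lift_def Let_def y_def z_def Y_def)
  show ?thesis
    using block3_combination[OF assms] by (simp add: p q s y z Y)
qed

lemma continuous_on_matrix:
  fixes M :: "'c::topological_space \<Rightarrow> real ^ 'k ^ 'm"
  assumes "\<And>i j. continuous_on S (\<lambda>p. M p $ i $ j)"
  shows "continuous_on S M"
proof -
  have "continuous_on S (\<lambda>p. \<chi> i j. M p $ i $ j)"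
    using assms by (intro continuous_on_vec_lambda)
  then show ?thesis by simp
qed

lemma block3_index_cases:
  fixes i :: "1 + ('n + 1)"
  obtains "i = Inl 1" | k where "i = Inr (Inl k)" | "i = Inr (Inr 1)"
  by (metis num1_eq1 sum.exhaust)

lemma continuous_on_block3:
  assumes "continuous_on S x" "continuous_on S X" "continuous_on S y" "continuous_on S z" "continuous_on S Y"
  shows "continuous_on S (\<lambda>p. block3 (x p) (X p) (y p) (z p) (Y p))"
proof (rule continuous_on_matrix)
  fix i j
  show "continuous_on S (\<lambda>p. block3 (x p) (X p) (y p) (z p) (Y p) $ i $ j)"
    by (cases i rule: block3_index_cases; cases j rule: block3_index_cases)
       (auto simp: block3_def block2_def sym_block_def vapp_def mat_def rowvector_def columnvector_def
          intro!: continuous_intros assms)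
qed

lemma continuous_on_slack_lift: "continuous_on UNIV (slack_lift f g d)"
proof -
  have "continuous_on UNIV (\<lambda>p :: (real ^ 'n) \<times> (real ^ 'n ^ 'n). snd p *v f)" for f :: "real ^ 'n"
    unfolding matrix_vector_mult_def by (intro continuous_on_vec_lambda continuous_intros)
  then have "continuous_on UNIV (\<lambda>p. slack_lift f g d p)"
    unfolding slack_lift_def Let_def divide_inverse
    by (intro continuous_on_block3 continuous_intros)
  then show ?thesis by simp
qed

text \<open>
  Membership of \<open>(x, X)\<close> involves an existential quantifier over the slack part.  The latter being
  unique, the projection becomes a preimage, and closedness is inherited.
\<close>

lemma X_second_eq:
  assumes "g \<noteq> 0"
  shows "X_second (F_second K f g d) = 
    {p. transpose (snd p) = snd p} \<inter> slack_lift f g d -` lift_hull (F_second K f g d)"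
proof -
  have "block3 x X y z Y = slack_lift f g d (x, X)" 
    if "block3 x X y z Y \<in> lift_hull (F_second K f g d)" for x X y z Y
    using assms by (intro block3_eq_slack_lift lift_hull_mult_eq_0[OF that]) (auto simp: F_second_eq)
  moreover have "\<exists>y Y z. slack_lift f g d (x, X) = block3 x X y z Y" for x X
    by (auto simp: slack_lift_def Let_def)
  ultimately show ?thesis unfolding X_second_def by (auto; metis)
qed

lemma closed_convex_symmetric:
  "closed {p :: (real ^ 'n) \<times> (real ^ 'n ^ 'n). transpose (snd p) = snd p}"
  "convex {p :: (real ^ 'n) \<times> (real ^ 'n ^ 'n). transpose (snd p) = snd p}"
proof -
  show "closed {p :: (real ^ 'n) \<times> (real ^ 'n ^ 'n). transpose (snd p) = snd p}"
    by (intro closed_Collect_eq) (auto simp: transpose_def intro!: continuous_intros)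
  show "convex {p :: (real ^ 'n) \<times> (real ^ 'n ^ 'n). transpose (snd p) = snd p}"
    by (rule convexI) (simp add: transpose_def vec_eq_iff)
qed

lemma closed_convex_X_second:
  assumes "g \<noteq> 0"
  shows "closed (X_second (F_second K f g d))" "convex (X_second (F_second K f g d))"
proof -
  show "closed (X_second (F_second K f g d))"
    unfolding X_second_eq[OF assms]
    by (intro closed_Int closed_convex_symmetric closed_vimage closed_convex_lift_hull continuous_on_slack_lift)
  show "convex (X_second (F_second K f g d))"
    unfolding X_second_eq[OF assms]
    by (intro convex_Int closed_convex_symmetric)
       (auto simp: convex_def slack_lift_affine intro!: convexD[OF closed_convex_lift_hull(2)])
qed

lemma X_first_eq:
  "X_first F = {p. transpose (snd p) = snd p} \<inter> (\<lambda>p. block2 (fst p) (snd p)) -` lift_hull F"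
  by (auto simp: X_first_def)

lemma closed_convex_X_first: "closed (X_first F)" "convex (X_first F)"
proof -
  have "continuous_on UNIV (\<lambda>p. block2 (fst p) (snd p :: real ^ 'a ^ 'a))"
  proof (rule continuous_on_matrix)
    fix i j
    show "continuous_on UNIV (\<lambda>p. block2 (fst p) (snd p :: real ^ 'a ^ 'a) $ i $ j)"
      by (cases i; cases j)
         (auto simp: block2_def sym_block_def mat_def rowvector_def intro!: continuous_intros)
  qed
  then show "closed (X_first F)"
    unfolding X_first_eq by (intro closed_Int closed_convex_symmetric closed_vimage closed_convex_lift_hull) simp
  have "block2 (u *\<^sub>R x + v *\<^sub>R x') (u *\<^sub>R X + v *\<^sub>R X') = u *\<^sub>R block2 x X + v *\<^sub>R block2 x' X'"
    if "u + v = 1" for u v and x x' :: "real ^ 'a" and X X'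
    using that by (auto simp: block2_def sym_block_def vec_eq_iff mat_def rowvector_def split: sum.split)
  then show "convex (X_first F)"
    unfolding X_first_eq by (intro convex_Int closed_convex_symmetric)
       (auto simp: convex_def intro!: convexD[OF closed_convex_lift_hull(2)])
qed

section \<open>Completion of the partial matrix\<close>

lemma closed_convex_X_all:
  assumes "\<And>i. g i > 0"
  shows "closed (X_all K f0 d0 f g d)" "convex (X_all K f0 d0 f g d)"
proof -
  have "g i \<noteq> 0" for i using assms[of i] by simp
  then show "closed (X_all K f0 d0 f g d)" "convex (X_all K f0 d0 f g d)"
    unfolding X_all_def
    by (auto intro!: closed_Int closed_INT convex_Int convex_INT closed_convex_X_first closed_convex_X_second)
qed

lemma quadratic_form_block3:
  "vapp (vec (- d)) (vapp f (vec g)) \<bullet> (block3 x X y z Y *v vapp (vec (- d)) (vapp f (vec g)))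
    = d\<^sup>2 - 2 * d * (f \<bullet> x + g * y) + (outer f \<bullet>\<^sub>F X + 2 * g * (f \<bullet> z) + g\<^sup>2 * Y)"
  by (simp add: block3_mult inner_vapp inner_vec1 frob_outer inner_simps inner_commute
      algebra_simps power2_eq_square)

lemma quadratic_form_block2:
  "vapp (vec (- d)) f \<bullet> (block2 x X *v vapp (vec (- d)) f)
    = d\<^sup>2 - 2 * d * (f \<bullet> x) + outer f \<bullet>\<^sub>F X"
  by (simp add: block2_mult inner_vapp inner_vec1 frob_outer inner_simps inner_commute
      algebra_simps power2_eq_square)

lemma outer_vapp_block3:
  "outer (vapp (vec 1) (vapp x (vec y))) = block3 x (outer x) y (y *\<^sub>R x) (y\<^sup>2)"
  by (auto simp: block3_def block2_def sym_block_def vec_eq_iff outer_def mat_def rowvector_def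
      columnvector_def power2_eq_square split: sum.split)

lemma slack_lift_outer:
  assumes "f \<bullet> x + g * y = d" "g \<noteq> 0"
  shows "slack_lift f g d (x, outer x) = outer (vapp (vec 1) (vapp x (vec y)))"
  unfolding outer_vapp_block3 
proof (rule block3_eq_slack_lift[symmetric])
  have "x \<bullet> f + y * g = d" using assms(1) by (simp add: inner_commute mult.commute)
  then show "block3 x (outer x) y (y *\<^sub>R x) (y\<^sup>2) *v vapp (vec (- d)) (vapp f (vec g)) = 0"
    unfolding outer_vapp_block3[symmetric] by (simp add: outer_mult inner_vapp inner_vec1)
qed fact

text \<open>
  Every specified entry of an arrowhead partial matrix lies in one of the blocks indexed by
  \<open>arrow_emb s\<close>.
\<close>

lemma arrow_emb_cover:
  assumes "{i, j} \<in> arrowhead \<or> i = j"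
  shows "\<exists>s p q. i = arrow_emb s p \<and> j = arrow_emb s q"
proof -
  have L: "\<exists>p. Inl u = arrow_emb s p" for u :: "1 + 'n" and s :: 's
  proof (cases u)
    case (Inl a) then show ?thesis by (intro exI[of _ "Inl a"]) (simp add: arrow_emb_def)
  next
    case (Inr b) then show ?thesis by (intro exI[of _ "Inr (Inl b)"]) (simp add: arrow_emb_def)
  qed
  have R: "\<exists>p. Inr (s, b) = arrow_emb s p" for s :: 's and b :: 1
    by (intro exI[of _ "Inr (Inr b)"]) (simp add: arrow_emb_def)
  from assms consider u where "i = Inl u" | u where "j = Inl u"
    | s b b' where "i = Inr (s, b)" "j = Inr (s, b')"
    unfolding arrowhead_def by (cases i; cases j) (auto simp: doubleton_eq_iff)
  then show ?thesis
    by cases (metis L R surj_pair sum.exhaust)+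
qed

lemma X_all_rank_one:
  assumes "closed K" "convex K" "(v, outer v) \<in> X_all K f0 d0 f g d" "\<And>i. g i > 0"
  shows "v \<in> K" "\<exists>y\<ge>0. f s \<bullet> v + g s * y = d s"
proof -
  have "block2 v (outer v) \<in> lift_hull (F_first K f0 d0)"
    using assms(3) by (auto simp: X_all_def X_first_def)
  then have "v \<in> F_first K f0 d0"
    by (rule lift_hull_first_row) (simp_all add: F_first_def closed_convex_slice assms)
  then show "v \<in> K" by (simp add: F_first_def)
  have "(v, outer v) \<in> X_second (F_second K (f s) (g s) (d s))"
    using assms(3) by (auto simp: X_all_def)
  then obtain y Y z where "block3 v (outer v) y z Y \<in> lift_hull (F_second K (f s) (g s) (d s))"
    by (auto simp: X_second_def)
  then have "vapp v (vec y) \<in> F_second K (f s) (g s) (d s)"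
    unfolding block3_def F_second_eq
    by (rule lift_hull_first_row) (intro closed_convex_slice closed_vprod convex_vprod nonneg_orthant assms)+
  then show "\<exists>y\<ge>0. f s \<bullet> v + g s * y = d s"
    by (auto simp: F_second_def)
qed

theorem theorem10:
  fixes K :: "(real ^ 'n) set"
    and f0 :: "real ^ 'n" and d0 :: real
    and f :: "'s::finite \<Rightarrow> real ^ 'n" and g d :: "'s \<Rightarrow> real"
    and MG :: "((1 + 'n) + 's \<times> 1) partial_matrix"
    and x :: "real ^ 'n" and X :: "real ^ 'n ^ 'n"
    and y Y :: "'s \<Rightarrow> real" and z :: "'s \<Rightarrow> real ^ 'n"
  assumes "K \<noteq> {}" and "closed K" and "convex K" and "cone K"
    and "\<And>i. g i > 0"
    and "bounded (X_all K f0 d0 f g d)"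
    and "\<And>p. p extreme_point_of X_all K f0 d0 f g d \<Longrightarrow> \<exists>v. p = (v, outer v)"
    and "MG \<in> PCP arrowhead ((nonneg_orthant \<times>\<^sub>v K) \<times>\<^sub>v nonneg_orthant)"
    and "transpose X = X"
    and "\<And>i. principal_submatrix MG (arrow_emb i) (block3 x X (y i) (z i) (Y i))"
    and "\<And>i. block3 x X (y i) (z i) (Y i) \<in> CPP (nonneg_orthant \<times>\<^sub>v K \<times>\<^sub>v nonneg_orthant)"
    and "\<And>i. f i \<bullet> x + g i * y i = d i"
    and "\<And>i. outer (f i) \<bullet>\<^sub>F X + 2 * g i * (f i \<bullet> z i) + (g i)\<^sup>2 * Y i = (d i)\<^sup>2"
    and "f0 \<bullet> x = d0"
    and "outer f0 \<bullet>\<^sub>F X = d0\<^sup>2"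
  shows "\<exists>M \<in> CPP ((nonneg_orthant \<times>\<^sub>v K) \<times>\<^sub>v nonneg_orthant). completes M MG"
proof -
  define XX where "XX = X_all K f0 d0 f g d"
  define C where "C = ((nonneg_orthant :: (real ^ 1) set) \<times>\<^sub>v K) \<times>\<^sub>v (nonneg_orthant :: (real ^ ('s \<times> 1)) set)"
  have g0: "g i \<noteq> 0" for i using assms(5)[of i] by simp
  note K2 = cone_vprod[OF assms(4) nonneg_orthant(1)] convex_vprod[OF assms(3) nonneg_orthant(2)]
  have slice: "block3 x X (y i) (z i) (Y i) *v vapp (vec (- d i)) (vapp (f i) (vec (g i))) = 0"
    "block3 x X (y i) (z i) (Y i) \<in> lift_hull (F_second K (f i) (g i) (d i))" for i
  proof -
    have 1: "block3 x X (y i) (z i) (Y i) $ Inl 1 $ Inl 1 = 1"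
      by (simp add: block3_def block2_def sym_block_def mat_def)
    have 2: "vapp (vec (- d i)) (vapp (f i) (vec (g i))) \<bullet>
      (block3 x X (y i) (z i) (Y i) *v vapp (vec (- d i)) (vapp (f i) (vec (g i)))) = 0"
      unfolding quadratic_form_block3 assms by (simp add: power2_eq_square)
    show "block3 x X (y i) (z i) (Y i) *v vapp (vec (- d i)) (vapp (f i) (vec (g i))) = 0"
     "block3 x X (y i) (z i) (Y i) \<in> lift_hull (F_second K (f i) (g i) (d i))"
      unfolding F_second_eq using CPP_slice[OF K2 assms(11) 1 refl 2] by auto
  qed
  have sl: "block3 x X (y i) (z i) (Y i) = slack_lift (f i) (g i) (d i) (x, X)" for i
    by (rule block3_eq_slack_lift[OF slice(1) g0])
  have "block2 x X \<in> lift_hull (F_first K f0 d0)"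
    unfolding F_first_def
  proof (rule CPP_slice[OF assms(4,3) _ _ refl])
    \<comment> \<open>\<open>block2 x X\<close> is a submatrix of any of the blocks; an index exists because types are nonempty.\<close>
    obtain i :: 's where True by simp
    define e :: "1 + 'n \<Rightarrow> 1 + ('n + 1)" where "e p = (case p of Inl u \<Rightarrow> Inl u | Inr j \<Rightarrow> Inr (Inl j))" for p
    have "submatrix e (block3 x X (y i) (z i) (Y i)) \<in> CPP (nonneg_orthant \<times>\<^sub>v K)"
    proof (rule submatrix_CPP[OF assms(11)])
      fix v :: "real ^ (1 + ('n + 1))"
      assume "v \<in> nonneg_orthant \<times>\<^sub>v K \<times>\<^sub>v nonneg_orthant"
      then obtain a b c where "v = vapp a (vapp b c)" "a \<in> nonneg_orthant" "b \<in> K"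
        unfolding vprod_def by blast
      moreover from this have "(\<chi> p. v $ e p) = vapp a b"
        by (auto simp: vec_eq_iff vapp_def e_def split: sum.split)
      ultimately show "(\<chi> p. v $ e p) \<in> nonneg_orthant \<times>\<^sub>v K" by simp
    qed
    also have "submatrix e (block3 x X (y i) (z i) (Y i)) = block2 x X"
      by (auto simp: submatrix_def e_def block3_def block2_def sym_block_def vec_eq_iff rowvector_def vapp_def
          split: sum.split)
    finally show "block2 x X \<in> CPP (nonneg_orthant \<times>\<^sub>v K)" .
    show "block2 x X $ Inl 1 $ Inl 1 = 1"
      by (simp add: block2_def sym_block_def mat_def)
    show "vapp (vec (- d0)) f0 \<bullet> (block2 x X *v vapp (vec (- d0)) f0) = 0"
      unfolding quadratic_form_block2 assms by (simp add: power2_eq_square)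
  qed
  then have "(x, X) \<in> XX"
    using assms(9) slice(2) by (auto simp: XX_def X_all_def X_first_def X_second_def)
  also have "XX = convex hull {p. p extreme_point_of XX}"
    using assms(6) closed_convex_X_all[OF assms(5)] unfolding XX_def
    by (intro Krein_Milman_Minkowski) (auto simp: compact_eq_bounded_closed)
  also have "\<dots> \<subseteq> {p. \<exists>M\<in>CPP C. \<forall>i. submatrix (arrow_emb i) M = slack_lift (f i) (g i) (d i) p}"
  proof (rule hull_minimal)
    show "{p. p extreme_point_of XX} \<subseteq>
      {p. \<exists>M\<in>CPP C. \<forall>i. submatrix (arrow_emb i) M = slack_lift (f i) (g i) (d i) p}"
    proof safe
      fix v V assume ext: "(v, V) extreme_point_of XX"
      then have V: "V = outer v" using assms(7)[of "(v, V)"] by (auto simp: XX_def)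
      have "(v, outer v) \<in> X_all K f0 d0 f g d"
        using ext V by (auto simp: extreme_point_of_def XX_def)
      note v = X_all_rank_one[OF assms(2,3) this assms(5)]
      from v(2) obtain t where t: "\<And>i. 0 \<le> t i" "\<And>i. f i \<bullet> v + g i * t i = d i" by metis
      define w :: "real ^ ((1 + 'n) + 's \<times> 1)" where "w = vapp (vapp (vec 1) v) (\<chi> k. t (fst k))"
      have "w \<in> C" using v(1) t(1) by (simp add: w_def C_def nonneg_orthant_def)
      then have "outer w \<in> CPP C" unfolding CPP_def by (auto intro: hull_inc)
      moreover have "submatrix (arrow_emb i) (outer w) = slack_lift (f i) (g i) (d i) (v, V)" for i
      proof -
        have "(\<chi> p. w $ arrow_emb i p) = vapp (vec 1) (vapp v (vec (t i)))"
          by (auto simp: w_def vec_eq_iff vapp_def arrow_emb_def split: sum.split)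
        then show ?thesis
          unfolding V submatrix_outer slack_lift_outer[OF t(2) g0] by simp
      qed
      ultimately show "\<exists>M\<in>CPP C. \<forall>i. submatrix (arrow_emb i) M = slack_lift (f i) (g i) (d i) (v, V)"
        by blast
    qed
    show "convex {p. \<exists>M\<in>CPP C. \<forall>i. submatrix (arrow_emb i) M = slack_lift (f i) (g i) (d i) p}"
      (is "convex ?W")
    proof (rule convexI)
      fix p q and u v :: real
      assume uv: "0 \<le> u" "0 \<le> v" "u + v = 1" and "p \<in> ?W" "q \<in> ?W"
      then obtain M N where MN: "M \<in> CPP C" "N \<in> CPP C"
        "\<And>i. submatrix (arrow_emb i) M = slack_lift (f i) (g i) (d i) p"
        "\<And>i. submatrix (arrow_emb i) N = slack_lift (f i) (g i) (d i) q"
        by blast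
      with uv have "submatrix (arrow_emb i) (u *\<^sub>R M + v *\<^sub>R N)
          = slack_lift (f i) (g i) (d i) (u *\<^sub>R p + v *\<^sub>R q)" for i
        by (simp add: linear_add linear_cmul linear_submatrix slack_lift_affine)
      moreover have "u *\<^sub>R M + v *\<^sub>R N \<in> CPP C"
        using uv MN by (auto simp: CPP_def intro: convexD[OF convex_convex_hull])
      ultimately show "u *\<^sub>R p + v *\<^sub>R q \<in> ?W" by blast
    qed
  qed
  finally obtain M where M: "M \<in> CPP C"
    "\<And>i. submatrix (arrow_emb i) M = block3 x X (y i) (z i) (Y i)" unfolding sl by blast
  have "completes M MG"
    unfolding completes_def
  proof (intro allI impI)
    fix i j assume "MG i j \<noteq> None"
    then have "{i, j} \<in> arrowhead \<or> i = j"
      using assms(8) unfolding PCP_def sym_partial_matrix_def by blast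
    then obtain s p q where ij: "i = arrow_emb s p" "j = arrow_emb s q" using arrow_emb_cover by blast
    have "M $ i $ j = submatrix (arrow_emb s) M $ p $ q"
      by (simp add: submatrix_def ij)
    then show "MG i j = Some (M $ i $ j)"
      using assms(10)[of s] by (simp add: M(2) ij principal_submatrix_def)
  qed
  then show ?thesis using M(1) unfolding C_def by blast
qed

end
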